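(* For the hypergeometric-Mittag-Leffler functions ${}_{{}_2F_1}E_{(\alpha,\beta)}(a_1,a_2;b_1;u)$, with $\alpha,\beta\in\mathbb{R}^{+}$, the following (indefinite) integral representation holds true: $$\int u^{\delta}\;{}_{{}_2F_1}E_{(\alpha,\beta)}(a_1,a_2;b_1;u)\,du=\frac{u^{\delta+1}}{\delta+1}\;{}_{{}_3F_2}E_{(\alpha,\beta)}(a_1,a_2,\delta+1;\,b_1,\delta+2;\,u).$$
   Context: $(a)_r=\Gamma(a+r)/\Gamma(a)$ is the Pochhammer symbol. The generalized hypergeometric-Mittag-Leffler functions are given by $${}_{{}_pF_q}E_{(\alpha,\beta)}(a_1,\dots,a_p;b_1,\dots,b_q;u)=\sum_{r=0}^{\infty}\frac{(a_1)_r\cdots(a_p)_r}{(b_1)_r\cdots(b_q)_r}\,\frac{u^r}{\Gamma(\alpha r+\beta)} ;$$ the case $p=2$, $q=1$ is the hypergeometric-Mittag-Leffler function. *)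

theory Defs
  imports "HOL-Analysis.Analysis"
begin

definition hypML_coeff ::
    "real \<Rightarrow> real \<Rightarrow> complex list \<Rightarrow> complex list \<Rightarrow> nat \<Rightarrow> complex" where
  "hypML_coeff \<alpha> \<beta> as bs r =
     (\<Prod>a\<leftarrow>as. pochhammer a r) / (\<Prod>b\<leftarrow>bs. pochhammer b r)
       / Gamma (complex_of_real (\<alpha> * real r + \<beta>))"

text \<open>The lengths of the two parameter lists are the indices \<open>p\<close> and \<open>q\<close>.  The value is
  meaningful only where the series converges and no element of \<open>bs\<close> is a non-positive integer.\<close>

definition hypML ::
    "real \<Rightarrow> real \<Rightarrow> complex list \<Rightarrow> complex list \<Rightarrow> complex \<Rightarrow> complex" where
  "hypML \<alpha> \<beta> as bs u = (\<Sum>r. hypML_coeff \<alpha> \<beta> as bs r * u ^ r)"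

text \<open>Principal power with the convention that the zeroth power is constantly 1; the library's
  \<open>powr\<close> has \<open>0 powr 0 = 0\<close>, which would make the integrand discontinuous at 0 for exponent 0.\<close>

definition cpow :: "complex \<Rightarrow> complex \<Rightarrow> complex" where
  "cpow u d = (if d = 0 then 1 else u powr d)"

end

theory Submission
  imports Defs
begin

text \<open>Since \<open>(\<delta> + 1)\<^sub>r / (\<delta> + 2)\<^sub>r = (\<delta> + 1) / (\<delta> + 1 + r)\<close>, the antiderivative is \<open>u\<^bsup>\<delta>+1\<^esup> F u / (\<delta> + 1)\<close>
  with \<open>F u = (\<Sum>r. c r (\<delta> + 1) / (\<delta> + 1 + r) u\<^sup>r)\<close>, where \<open>c r\<close> are the coefficients of the integrand's series.
  The factor \<open>(\<delta> + 1) / (\<delta> + 1 + r)\<close> is eventually at most 1 in modulus, so \<open>F\<close> converges where the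
  integrand does, and the product rule reduces the claim to the Euler-operator identity
  \<open>(\<delta> + 1) F u + u F' u = (\<delta> + 1) (\<Sum>r. c r u\<^sup>r)\<close>.\<close>

text \<open>Telescoping: \<open>s * pochhammer (s + 1) r\<close> and
  \<open>pochhammer s r * (s + of_nat r)\<close> are both \<open>pochhammer s (Suc r)\<close>. The
  hypothesis keeps both denominators nonzero.\<close>

lemma pochhammer_quotient_shift:
  fixes s :: "'a::field_char_0"
  assumes "s \<notin> \<int>\<^sub>\<le>\<^sub>0"
  shows "pochhammer s r / pochhammer (s + 1) r = s / (s + of_nat r)"
proof -
  have "s + 1 \<notin> \<int>\<^sub>\<le>\<^sub>0"
    using assms plus_one_in_nonpos_Ints_imp by blast
  then have "pochhammer (s + 1) r \<noteq> 0"
    by (auto simp: pochhammer_eq_0_iff)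
  moreover have "s + of_nat r \<noteq> 0"
    using assms by (metis add_eq_0_iff2 minus_of_nat_in_nonpos_Ints)
  moreover have "s * pochhammer (s + 1) r = pochhammer s r * (s + of_nat r)"
    by (metis mult.commute pochhammer_rec pochhammer_rec')
  ultimately show ?thesis
    by (simp add: frac_eq_eq)
qed

lemma conv_radius_antimono:
  assumes "\<forall>\<^sub>F n in sequentially. norm (f n) \<le> norm (g n)"
  shows "conv_radius g \<le> conv_radius f"
  unfolding conv_radius_def
proof (rule ereal_inverse_antimono)
  \<comment> \<open>Inversion on \<open>ereal\<close> reverses order only among nonnegative values,
    so the sign of the smaller limsup must be settled.\<close>
  have "0 = limsup (\<lambda>n. 0 :: ereal)"
    by (simp add: Limsup_const)
  also have "\<dots> \<le> limsup (\<lambda>n. ereal (root n (norm (f n))))"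
    by (intro Limsup_mono) (simp add: real_root_ge_zero)
  finally show "0 \<le> limsup (\<lambda>n. ereal (root n (norm (f n))))" .
  show "limsup (\<lambda>n. ereal (root n (norm (f n)))) \<le> limsup (\<lambda>n. ereal (root n (norm (g n))))"
    by (intro Limsup_mono eventually_elim2[OF assms eventually_gt_at_top[of 0]]) simp
qed

lemma summable_diffs_in_conv_radius:
  fixes c :: "nat \<Rightarrow> 'a::{real_normed_field,banach}"
  assumes "ereal (norm u) < conv_radius c"
  shows "summable (\<lambda>r. diffs c r * u ^ r)"
proof -
  \<comment> \<open>Termwise differentiation at \<open>u\<close> wants convergence on a larger disc
    of finite radius, while \<open>conv_radius c\<close> may be infinite.\<close>
  obtain K where K: "norm u < K" "ereal K < conv_radius c"
    using ereal_dense2[OF assms] by auto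
  show ?thesis
  proof (rule termdiff_converges[OF K(1)])
    show "summable (\<lambda>r. c r * x ^ r)" if "norm x < K" for x
      using that by (intro summable_in_conv_radius less_trans[OF _ K(2)]) simp
  qed
qed

lemma conv_radius_euler_quotient_ge:
  fixes c :: "nat \<Rightarrow> complex"
  shows "conv_radius c \<le> conv_radius (\<lambda>r. s / (s + of_nat r) * c r)"
proof (rule conv_radius_antimono)
  show "\<forall>\<^sub>F r in sequentially. norm (s / (s + of_nat r) * c r) \<le> norm (c r)"
    \<comment> \<open>Beyond this threshold, |s + r| >= r - |s| >= |s|.\<close>
    using eventually_ge_at_top[of "nat \<lceil>2 * norm s\<rceil>"]
  proof eventually_elim
    case (elim r)
    then have "2 * norm s \<le> norm (of_nat r :: complex)"
      by (simp add: nat_le_iff ceiling_le_iff)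
    moreover have "norm (of_nat r :: complex) \<le> norm (s + of_nat r) + norm s"
      using norm_triangle_ineq4[of "s + of_nat r" s] by simp
    ultimately have "norm s \<le> norm (s + of_nat r)"
      by linarith
    then have "norm (s / (s + of_nat r)) \<le> 1"
      by (simp add: norm_divide divide_le_eq_1)
    then show ?case
      by (simp only: norm_mult mult_left_le_one_le norm_ge_zero)
  qed
qed

text \<open>The operator u d/du multiplies the r-th coefficient by r, so s + u d/du multiplies it by
  s + r, which will cancel the denominators of F.\<close>

lemma euler_operator_powser:
  fixes c :: "nat \<Rightarrow> complex"
  assumes "ereal (norm u) < conv_radius c"
  shows "s * (\<Sum>r. c r * u ^ r) + u * (\<Sum>r. diffs c r * u ^ r) = (\<Sum>r. (s + of_nat r) * c r * u ^ r)"
proof -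
  have 1: "(\<lambda>r. s * (c r * u ^ r)) sums (s * (\<Sum>r. c r * u ^ r))"
    using summable_in_conv_radius[OF assms] by (intro sums_mult summable_sums)
  have 2: "(\<lambda>r. u * (of_nat r * c r * u ^ (r - Suc 0))) sums (u * (\<Sum>r. diffs c r * u ^ r))"
    by (intro sums_mult diffs_equiv summable_diffs_in_conv_radius assms)
  \<comment> \<open>At r = 0 the truncated exponent is harmless, as the factor
    \<open>of_nat r\<close> vanishes.\<close>
  have "s * (c r * u ^ r) + u * (of_nat r * c r * u ^ (r - Suc 0)) = (s + of_nat r) * c r * u ^ r" for r
    by (cases r) (simp_all add: algebra_simps)
  with sums_add[OF 1 2] have "(\<lambda>r. (s + of_nat r) * c r * u ^ r) sums
      (s * (\<Sum>r. c r * u ^ r) + u * (\<Sum>r. diffs c r * u ^ r))"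
    by simp
  then show ?thesis
    by (rule sums_unique)
qed

lemma hypML_coeff_append_shift:
  assumes "s \<notin> \<int>\<^sub>\<le>\<^sub>0"
  shows "hypML_coeff \<alpha> \<beta> (as @ [s]) (bs @ [s + 1]) r = s / (s + of_nat r) * hypML_coeff \<alpha> \<beta> as bs r"
  unfolding hypML_coeff_def pochhammer_quotient_shift[OF assms, symmetric] by (simp add: mult_ac)

text \<open>The convention for exponent 0 makes this true also at \<open>u = 0\<close>,
  \<open>n = 0\<close>.\<close>

lemma cpow_of_nat: "cpow u (of_nat n) = u ^ n"
  by (cases "u = 0") (auto simp: cpow_def powr_nat)

lemma cpow_add_1:
  assumes "u \<notin> \<real>\<^sub>\<le>\<^sub>0 \<or> d \<in> \<nat>"
  shows "cpow u (d + 1) = u * cpow u d"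
  using assms
proof
  assume "u \<notin> \<real>\<^sub>\<le>\<^sub>0"
  then have "u \<noteq> 0" by auto
  then have "cpow u e = u powr e" for e
    by (simp add: cpow_def)
  then show ?thesis
    using \<open>u \<noteq> 0\<close> by (simp add: powr_add)
next
  assume "d \<in> \<nat>"
  then obtain n where "d = of_nat n" by (elim Nats_cases)
  then show ?thesis
    using cpow_of_nat[of u n] cpow_of_nat[of u "Suc n"] by (simp add: add.commute)
qed

text \<open>Off the branch cut the principal power is holomorphic; for natural \<open>d\<close> the
  function is a monomial, hence differentiable on the cut and at 0 too.\<close>

lemma has_field_derivative_cpow:
  assumes "u \<notin> \<real>\<^sub>\<le>\<^sub>0 \<or> d \<in> \<nat>" "d + 1 \<noteq> 0"
  shows "((\<lambda>u. cpow u (d + 1)) has_field_derivative (d + 1) * cpow u d) (at u)"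
  using assms(1)
proof
  assume u: "u \<notin> \<real>\<^sub>\<le>\<^sub>0"
  then have "u \<noteq> 0" by auto
  then have "cpow u d = u powr d"
    by (simp add: cpow_def)
  moreover have "(\<lambda>u. cpow u (d + 1)) = (\<lambda>u. u powr (d + 1))"
    using assms(2) by (simp add: cpow_def)
  ultimately show ?thesis
    using has_field_derivative_powr[OF u, of "d + 1"] by simp
next
  assume "d \<in> \<nat>"
  then obtain n where n: "d = of_nat n" by (elim Nats_cases)
  have "(\<lambda>u. cpow u (d + 1)) = (\<lambda>u. u ^ Suc n)"
    using cpow_of_nat[of _ "Suc n"] by (simp add: n add.commute fun_eq_iff)
  moreover have "((\<lambda>u. u ^ Suc n) has_field_derivative (d + 1) * u ^ n) (at u)"
    by (rule derivative_eq_intros refl | simp add: n)+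
  ultimately show ?thesis
    by (simp only: n cpow_of_nat)
qed

theorem theorem5:
  fixes \<alpha> \<beta> :: real and a1 a2 b1 \<delta> u :: complex
  assumes "\<alpha> > 0" and "\<beta> > 0"
    and "b1 \<notin> \<int>\<^sub>\<le>\<^sub>0"
    and "\<delta> + 1 \<noteq> 0" and "\<delta> + 2 \<notin> \<int>\<^sub>\<le>\<^sub>0"
    and "ereal (norm u) < conv_radius (hypML_coeff \<alpha> \<beta> [a1, a2] [b1])"
    and "u \<notin> \<real>\<^sub>\<le>\<^sub>0 \<or> \<delta> \<in> \<nat>"
  shows "((\<lambda>u. cpow u (\<delta> + 1) / (\<delta> + 1) * hypML \<alpha> \<beta> [a1, a2, \<delta> + 1] [b1, \<delta> + 2] u)
           has_field_derivative cpow u \<delta> * hypML \<alpha> \<beta> [a1, a2] [b1] u) (at u)"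
proof -
  define s where "s = \<delta> + 1"
  define c where "c = hypML_coeff \<alpha> \<beta> [a1, a2] [b1]"
  define c' where "c' = hypML_coeff \<alpha> \<beta> [a1, a2, s] [b1, s + 1]"
  have s2: "\<delta> + 2 = s + 1" by (simp add: s_def)
  have s0: "s \<noteq> 0" using assms(4) by (simp add: s_def)
  \<comment> \<open>The condition on \<delta> + 2 excludes s = -1, -2, ...; only s = 0 is left, and
    \<open>s0\<close> excludes it.\<close>
  have s: "s \<notin> \<int>\<^sub>\<le>\<^sub>0"
  proof
    assume "s \<in> \<int>\<^sub>\<le>\<^sub>0"
    then obtain n where n: "s = - of_nat n" by (elim nonpos_Ints_cases')
    with s0 obtain m where "n = Suc m" by (cases n) auto
    with n have "s + 1 = - of_nat m" by simp
    with assms(5) show False unfolding s2 by simp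
  qed
  have c': "c' = (\<lambda>r. s / (s + of_nat r) * c r)"
    using hypML_coeff_append_shift[OF s, of \<alpha> \<beta> "[a1, a2]" "[b1]"] by (simp add: c_def c'_def fun_eq_iff)
  have conv: "ereal (norm u) < conv_radius c'"
    using assms(6) conv_radius_euler_quotient_ge[of c s] unfolding c' c_def by (rule less_le_trans)
  have "s + of_nat r \<noteq> 0" for r
    using s by (metis add_eq_0_iff2 minus_of_nat_in_nonpos_Ints)
  then have coeff: "(s + of_nat r) * c' r = s * c r" for r
    by (simp add: c')
  have "s * (\<Sum>r. c' r * u ^ r) + u * (\<Sum>r. diffs c' r * u ^ r) = (\<Sum>r. s * (c r * u ^ r))"
    unfolding euler_operator_powser[OF conv] coeff by (simp add: mult.assoc)
  also have "\<dots> = s * (\<Sum>r. c r * u ^ r)"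
    using summable_in_conv_radius[OF assms(6)] by (intro suminf_mult) (simp add: c_def)
  finally have euler: "(\<Sum>r. c' r * u ^ r) + u * (\<Sum>r. diffs c' r * u ^ r) / s = (\<Sum>r. c r * u ^ r)"
    using s0 by (simp add: field_simps)
  have "((\<lambda>u. cpow u s / s * (\<Sum>r. c' r * u ^ r)) has_field_derivative
      s * cpow u \<delta> / s * (\<Sum>r. c' r * u ^ r) + (\<Sum>r. diffs c' r * u ^ r) * (cpow u s / s)) (at u)"
    using has_field_derivative_cpow[OF assms(7,4)]
    by (intro DERIV_mult DERIV_cdivide has_field_derivative_powser[OF conv]) (simp add: s_def)
  \<comment> \<open>Writing \<open>cpow u s\<close> as \<open>u * cpow u \<delta>\<close> pulls out
    the common power and leaves the left side of \<open>euler\<close>.\<close>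
  moreover have "s * cpow u \<delta> / s * (\<Sum>r. c' r * u ^ r) + (\<Sum>r. diffs c' r * u ^ r) * (cpow u s / s)
      = cpow u \<delta> * ((\<Sum>r. c' r * u ^ r) + u * (\<Sum>r. diffs c' r * u ^ r) / s)"
    using s0 cpow_add_1[OF assms(7), folded s_def] by (simp add: algebra_simps)
  ultimately show ?thesis
    unfolding euler hypML_def s2 by (simp add: s_def[symmetric] c_def c'_def)
qed

end
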